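(* Let $\mathcal{R}=\mathbb{C}[\partial]A\oplus\mathbb{C}[\partial]B$ be a solvable rank two Lie conformal algebra, let $V_{\phi_A,\phi_B}$ be a nontrivial finite irreducible $\mathcal{R}$-module and let $\eta\in\mathbb{C}$. Then nontrivial extensions of $\mathcal{R}$-modules of the form $$0\longrightarrow V_{\phi_A,\phi_B}\longrightarrow E\longrightarrow\mathbb{C}c_\eta\longrightarrow0$$ do not exist, that is, $\dim\mathrm{Ext}(\mathbb{C}c_\eta,V_{\phi_A,\phi_B})=0$.
   Context: Everything is over $\mathbb{C}$. A Lie conformal algebra $\mathcal{R}$ is a $\mathbb{C}[\partial]$-module with a $\mathbb{C}$-linear $\lambda$-bracket $\mathcal{R}\otimes\mathcal{R}\to\mathcal{R}[\lambda]$, $a\otimes b\mapsto[a_\lambda b]$, satisfying $[\partial a_\lambda b]=-\lambda[a_\lambda b]$, $[a_\lambda\partial b]=(\partial+\lambda)[a_\lambda b]$, $[a_\lambda b]=-[b_{-\lambda-\partial}a]$ and $[a_\lambda[b_\mu c]]=[[a_\lambda b]_{\lambda+\mu}c]+[b_\mu[a_\lambda c]]$. A conformal $\mathcal{R}$-module $V$ is a $\mathbb{C}[\partial]$-module with a $\mathbb{C}$-linear map $\mathcal{R}\otimes V\to V[\lambda]$, $a\otimes v\mapsto a_\lambda v$, satisfying $(\partial a)_\lambda v=-\lambda(a_\lambda v)$, $a_\lambda(\partial v)=(\partial+\lambda)a_\lambda v$, $a_\lambda(b_\mu v)=[a_\lambda b]_{\lambda+\mu}v+b_\mu(a_\lambda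 v)$. For $\eta\in\mathbb{C}$, $\mathbb{C}c_\eta$ is the one-dimensional module with $\partial c_\eta=\eta c_\eta$ and $\mathcal{R}_\lambda c_\eta=0$. An extension of $W$ by $V$ is an exact sequence of modules $0\to V\to E\to W\to0$. Two extensions $E,E'$ are equivalent if there is a module homomorphism $E\to E'$ compatible with the identity maps of $V$ and $W$. An extension is trivial if it is equivalent to $V\oplus W$. $\mathrm{Ext}(W,V)$ is the vector space of extension cocycles modulo those equivalent to the trivial extension, and $\dim\mathrm{Ext}(W,V)$ is its dimension. A solvable rank two Lie conformal algebra (free of rank two over $\mathbb{C}[\partial]$) has a basis $\{A,B\}$, which is fixed, such that $[A_\lambda A]=Q_1(\partial,\lambda)B$, $[A_\lambda B]=p(\lambda)B$, $[B_\lambda B]=0$, where $p(\lambda)$ is a polynomial and $Q_1$ is a skew-symmetric polynomial, i.e. $Q_1(\partial,\lambda)=-Q_1(\partial,-\lambda-\partial)$, with $p(\lambda)Q_1(\partial,\lambda)=0$. Its nontrivial finite irreducible modules are $V_{\phi_A,\phi_B}=\mathbb{C}[\partial]v$ (free of rank one), $A_\lambda v=\phi_A(\lambda)v$, $B_\lambda v=\phi_B(\lambda)v$, where $\phi_A,\phi_B\in\mathbb{C}[\lambda]$ are not both zero, and $\phi_B\neq0$ only if $p=Q_1=0$. *)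

theory Defs
  imports
    "HOL-Computational_Algebra.Polynomial"
    "HOL-Library.Product_Plus"
    "HOL-Library.Function_Algebras"
    "HOL-Library.Extended_Nat"
begin

text \<open>
  A \<open>\<complex>[\<partial>]\<close>-module is a \<^locale>\<open>module\<close> over the ring \<^typ>\<open>complex poly\<close>: the generator \<open>\<partial>\<close> acts as
  \<open>s [:0, 1:]\<close> and a scalar \<open>c\<close> acts as \<open>s [:c:]\<close>. An element of \<open>X[\<lambda>]\<close>, for an abelian group \<open>X\<close>, is
  a formal polynomial with coefficients in \<open>X\<close> (type \<open>'x poly\<close>), so that multiplication by \<open>\<lambda>\<close> is
  \<open>pCons 0\<close>. An element of \<open>X[\<lambda>, \<mu>]\<close> has type \<open>'x poly poly\<close>, with outer variable \<open>\<mu>\<close> and inner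
  variable \<open>\<lambda>\<close>.
\<close>

abbreviation der :: "(complex poly \<Rightarrow> 'x \<Rightarrow> 'x) \<Rightarrow> 'x \<Rightarrow> 'x"
  where "der s \<equiv> s [:0, 1:]"

abbreviation cscale :: "(complex poly \<Rightarrow> 'x \<Rightarrow> 'x) \<Rightarrow> complex \<Rightarrow> 'x \<Rightarrow> 'x"
  where "cscale s c \<equiv> s [:c:]"

text \<open>\<open>psubst T \<iota> (\<Sum> t^n x_n) = \<Sum> T^n (\<iota> x_n)\<close>: the operator \<open>T\<close> is substituted for the variable.\<close>

definition psubst :: "('y \<Rightarrow> 'y) \<Rightarrow> ('x::zero \<Rightarrow> 'y::comm_monoid_add) \<Rightarrow> 'x poly \<Rightarrow> 'y"
  where "psubst T \<iota> q = (\<Sum>n\<le>degree q. (T ^^ n) (\<iota> (coeff q n)))"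

abbreviation (input) mul_lam :: "'x::zero poly poly \<Rightarrow> 'x poly poly"
  where "mul_lam \<equiv> map_poly (pCons 0)"

abbreviation (input) mul_mu :: "'x::zero poly poly \<Rightarrow> 'x poly poly"
  where "mul_mu \<equiv> pCons 0"

abbreviation (input) const2 :: "'x::zero \<Rightarrow> 'x poly poly"
  where "const2 x \<equiv> [:[:x:]:]"


section \<open>Lie conformal algebras and conformal modules\<close>

text \<open>The product is \<open>br a b = [a\<^sub>\<lambda> b]\<close>, a polynomial in \<open>\<lambda>\<close>.\<close>

locale lie_conformal_algebra = module s
  for s :: "complex poly \<Rightarrow> 'r::ab_group_add \<Rightarrow> 'r" +
  fixes br :: "'r \<Rightarrow> 'r \<Rightarrow> 'r poly"
  assumes br_add_left: "br (a + a') b = br a b + br a' b"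
    and br_add_right: "br a (b + b') = br a b + br a b'"
    and br_scale_left: "br (cscale s z a) b = map_poly (cscale s z) (br a b)"
    and br_scale_right: "br a (cscale s z b) = map_poly (cscale s z) (br a b)"
    and br_der_left: "br (der s a) b = - pCons 0 (br a b)"
    and br_der_right: "br a (der s b) = map_poly (der s) (br a b) + pCons 0 (br a b)"
    and br_skew: "br a b = - psubst (\<lambda>q. - pCons 0 q - map_poly (der s) q) (\<lambda>x. [:x:]) (br b a)"
    and br_jacobi:
      "psubst mul_mu (\<lambda>x. psubst mul_lam const2 (br a x)) (br b c) =
       psubst mul_lam (\<lambda>x. psubst (\<lambda>q. mul_lam q + mul_mu q) const2 (br x c)) (br a b) +
       psubst mul_lam (\<lambda>x. psubst mul_mu const2 (br b x)) (br a c)"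
begin

definition derived :: "'r set \<Rightarrow> 'r set"
  where "derived M = span {coeff (br a b) n | a b n. a \<in> M \<and> b \<in> M}"

definition solvable :: bool
  where "solvable \<longleftrightarrow> (\<exists>n. (derived ^^ n) UNIV = {0})"

end

locale conformal_module =
  L: lie_conformal_algebra s br + M: module sV
  for s :: "complex poly \<Rightarrow> 'r::ab_group_add \<Rightarrow> 'r" and br :: "'r \<Rightarrow> 'r \<Rightarrow> 'r poly"
    and sV :: "complex poly \<Rightarrow> 'v::ab_group_add \<Rightarrow> 'v" +
  fixes act :: "'r \<Rightarrow> 'v \<Rightarrow> 'v poly"
  assumes act_add_left: "act (a + a') v = act a v + act a' v"
    and act_add_right: "act a (v + v') = act a v + act a v'"
    and act_scale_left: "act (cscale s z a) v = map_poly (cscale sV z) (act a v)"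
    and act_scale_right: "act a (cscale sV z v) = map_poly (cscale sV z) (act a v)"
    and act_der_left: "act (der s a) v = - pCons 0 (act a v)"
    and act_der_right: "act a (der sV v) = map_poly (der sV) (act a v) + pCons 0 (act a v)"
    and act_jacobi:
      "psubst mul_mu (\<lambda>x. psubst mul_lam const2 (act a x)) (act b v) =
       psubst mul_lam (\<lambda>x. psubst (\<lambda>q. mul_lam q + mul_mu q) const2 (act x v)) (br a b) +
       psubst mul_lam (\<lambda>x. psubst mul_mu const2 (act b x)) (act a v)"
begin

definition conformal_submodule :: "'v set \<Rightarrow> bool"
  where "conformal_submodule N \<longleftrightarrow>
    M.subspace N \<and> (\<forall>a. \<forall>v\<in>N. \<forall>n. coeff (act a v) n \<in> N)"

definition irreducible_module :: bool
  where "irreducible_module \<longleftrightarrow>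
    (\<exists>v::'v. v \<noteq> 0) \<and> (\<forall>N. conformal_submodule N \<longrightarrow> N = {0} \<or> N = UNIV)"

definition finite_module :: bool
  where "finite_module \<longleftrightarrow> (\<exists>S. finite S \<and> M.span S = UNIV)"

end

definition conformal_hom ::
    "(complex poly \<Rightarrow> 'v \<Rightarrow> 'v) \<Rightarrow> ('r \<Rightarrow> 'v \<Rightarrow> 'v poly) \<Rightarrow>
     (complex poly \<Rightarrow> 'w \<Rightarrow> 'w) \<Rightarrow> ('r \<Rightarrow> 'w \<Rightarrow> 'w poly) \<Rightarrow>
     ('v::ab_group_add \<Rightarrow> 'w::ab_group_add) \<Rightarrow> bool"
  where "conformal_hom sV actV sW actW h \<longleftrightarrow>
    module_hom sV sW h \<and> (\<forall>a v. actW a (h v) = map_poly h (actV a v))"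

text \<open>The one-dimensional module \<open>\<complex>c\<^sub>\<eta>\<close>, with \<open>c\<^sub>\<eta> = 1\<close> in \<^typ>\<open>complex\<close>.\<close>

definition triv_scale :: "complex \<Rightarrow> complex poly \<Rightarrow> complex \<Rightarrow> complex"
  where "triv_scale \<eta> q z = poly q \<eta> * z"

definition triv_act :: "'r \<Rightarrow> complex \<Rightarrow> complex poly"
  where "triv_act a z = 0"


section \<open>Extensions\<close>

definition is_extension ::
    "(complex poly \<Rightarrow> 'r::ab_group_add \<Rightarrow> 'r) \<Rightarrow> ('r \<Rightarrow> 'r \<Rightarrow> 'r poly) \<Rightarrow>
     (complex poly \<Rightarrow> 'v \<Rightarrow> 'v) \<Rightarrow> ('r \<Rightarrow> 'v \<Rightarrow> 'v poly) \<Rightarrow>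
     (complex poly \<Rightarrow> 'w \<Rightarrow> 'w) \<Rightarrow> ('r \<Rightarrow> 'w \<Rightarrow> 'w poly) \<Rightarrow>
     (complex poly \<Rightarrow> 'e \<Rightarrow> 'e) \<Rightarrow> ('r \<Rightarrow> 'e \<Rightarrow> 'e poly) \<Rightarrow>
     ('v::ab_group_add \<Rightarrow> 'e::ab_group_add) \<Rightarrow> ('e \<Rightarrow> 'w::ab_group_add) \<Rightarrow> bool"
  where "is_extension s br sV actV sW actW sE actE \<iota> \<pi> \<longleftrightarrow>
    conformal_module s br sE actE \<and>
    conformal_hom sV actV sE actE \<iota> \<and> conformal_hom sE actE sW actW \<pi> \<and>
    inj \<iota> \<and> range \<iota> = {e. \<pi> e = 0} \<and> surj \<pi>"

definition equivalent_extensions ::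
    "(complex poly \<Rightarrow> 'e \<Rightarrow> 'e) \<Rightarrow> ('r \<Rightarrow> 'e \<Rightarrow> 'e poly) \<Rightarrow> ('v \<Rightarrow> 'e::ab_group_add) \<Rightarrow> ('e \<Rightarrow> 'w) \<Rightarrow>
     (complex poly \<Rightarrow> 'f \<Rightarrow> 'f) \<Rightarrow> ('r \<Rightarrow> 'f \<Rightarrow> 'f poly) \<Rightarrow>
     ('v \<Rightarrow> 'f::ab_group_add) \<Rightarrow> ('f \<Rightarrow> 'w) \<Rightarrow> bool"
  where "equivalent_extensions sE actE \<iota> \<pi> sF actF \<iota>' \<pi>' \<longleftrightarrow>
    (\<exists>h. conformal_hom sE actE sF actF h \<and> h \<circ> \<iota> = \<iota>' \<and> \<pi>' \<circ> h = \<pi>)"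

definition sum_scale ::
    "(complex poly \<Rightarrow> 'v \<Rightarrow> 'v) \<Rightarrow> (complex poly \<Rightarrow> 'w \<Rightarrow> 'w) \<Rightarrow> complex poly \<Rightarrow> 'v \<times> 'w \<Rightarrow> 'v \<times> 'w"
  where "sum_scale sV sW q = map_prod (sV q) (sW q)"

definition sum_act ::
    "('r \<Rightarrow> 'v \<Rightarrow> 'v poly) \<Rightarrow> ('r \<Rightarrow> 'w \<Rightarrow> 'w poly) \<Rightarrow>
     'r \<Rightarrow> 'v::ab_group_add \<times> 'w::ab_group_add \<Rightarrow> ('v \<times> 'w) poly"
  where "sum_act actV actW a x =
    map_poly (\<lambda>v. (v, 0)) (actV a (fst x)) + map_poly (\<lambda>w. (0, w)) (actW a (snd x))"

definition trivial_extension ::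
    "(complex poly \<Rightarrow> 'v \<Rightarrow> 'v) \<Rightarrow> ('r \<Rightarrow> 'v \<Rightarrow> 'v poly) \<Rightarrow>
     (complex poly \<Rightarrow> 'w \<Rightarrow> 'w) \<Rightarrow> ('r \<Rightarrow> 'w \<Rightarrow> 'w poly) \<Rightarrow>
     (complex poly \<Rightarrow> 'e \<Rightarrow> 'e) \<Rightarrow> ('r \<Rightarrow> 'e \<Rightarrow> 'e poly) \<Rightarrow>
     ('v::ab_group_add \<Rightarrow> 'e::ab_group_add) \<Rightarrow> ('e \<Rightarrow> 'w::ab_group_add) \<Rightarrow> bool"
  where "trivial_extension sV actV sW actW sE actE \<iota> \<pi> \<longleftrightarrow>
    equivalent_extensions sE actE \<iota> \<pi>
      (sum_scale sV sW) (sum_act actV actW) (\<lambda>v. (v, 0)) snd"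


section \<open>Cocycles and the dimension of Ext\<close>

text \<open>
  An extension of \<open>W\<close> by \<open>V\<close> splits over \<open>\<complex>\<close>, hence is carried by \<open>V \<times> W\<close> with
  \<open>\<partial>(v, w) = (\<partial>v + f w, \<partial>w)\<close> and \<open>a\<^sub>\<lambda>(v, w) = (a\<^sub>\<lambda>v + \<gamma> a w, a\<^sub>\<lambda>w)\<close>; the pair \<open>(f, \<gamma>)\<close> is its cocycle.
  The action of \<open>\<complex>[\<partial>]\<close> is obtained by substituting the twisted \<open>\<partial>\<close> into polynomials.
\<close>

type_synonym ('r, 'v, 'w) cochain = "('w \<Rightarrow> 'v) \<times> ('r \<Rightarrow> 'w \<Rightarrow> 'v poly)"

definition twisted_scale ::
    "(complex poly \<Rightarrow> 'v \<Rightarrow> 'v) \<Rightarrow> (complex poly \<Rightarrow> 'w \<Rightarrow> 'w) \<Rightarrow> ('w \<Rightarrow> 'v) \<Rightarrow>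
     complex poly \<Rightarrow> 'v::ab_group_add \<times> 'w::ab_group_add \<Rightarrow> 'v \<times> 'w"
  where "twisted_scale sV sW f q x =
    psubst (\<lambda>(v, w). (der sV v + f w, der sW w)) (\<lambda>c. cscale (sum_scale sV sW) c x) q"

definition twisted_act ::
    "('r \<Rightarrow> 'v \<Rightarrow> 'v poly) \<Rightarrow> ('r \<Rightarrow> 'w \<Rightarrow> 'w poly) \<Rightarrow> ('r \<Rightarrow> 'w \<Rightarrow> 'v poly) \<Rightarrow>
     'r \<Rightarrow> 'v::ab_group_add \<times> 'w::ab_group_add \<Rightarrow> ('v \<times> 'w) poly"
  where "twisted_act actV actW \<gamma> a x =
    sum_act actV actW a x + map_poly (\<lambda>v. (v, 0)) (\<gamma> a (snd x))"

definition cocycles ::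
    "(complex poly \<Rightarrow> 'r \<Rightarrow> 'r) \<Rightarrow> ('r \<Rightarrow> 'r \<Rightarrow> 'r poly) \<Rightarrow>
     (complex poly \<Rightarrow> 'v \<Rightarrow> 'v) \<Rightarrow> ('r \<Rightarrow> 'v \<Rightarrow> 'v poly) \<Rightarrow>
     (complex poly \<Rightarrow> 'w \<Rightarrow> 'w) \<Rightarrow> ('r \<Rightarrow> 'w \<Rightarrow> 'w poly) \<Rightarrow>
     ('r::ab_group_add, 'v::ab_group_add, 'w::ab_group_add) cochain set"
  where "cocycles s br sV actV sW actW =
    {(f, \<gamma>). is_extension s br sV actV sW actW
       (twisted_scale sV sW f) (twisted_act actV actW \<gamma>) (\<lambda>v. (v, 0)) snd}"

definition trivial_cocycles ::
    "(complex poly \<Rightarrow> 'r \<Rightarrow> 'r) \<Rightarrow> ('r \<Rightarrow> 'r \<Rightarrow> 'r poly) \<Rightarrow>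
     (complex poly \<Rightarrow> 'v \<Rightarrow> 'v) \<Rightarrow> ('r \<Rightarrow> 'v \<Rightarrow> 'v poly) \<Rightarrow>
     (complex poly \<Rightarrow> 'w \<Rightarrow> 'w) \<Rightarrow> ('r \<Rightarrow> 'w \<Rightarrow> 'w poly) \<Rightarrow>
     ('r::ab_group_add, 'v::ab_group_add, 'w::ab_group_add) cochain set"
  where "trivial_cocycles s br sV actV sW actW =
    {(f, \<gamma>) \<in> cocycles s br sV actV sW actW. trivial_extension sV actV sW actW
       (twisted_scale sV sW f) (twisted_act actV actW \<gamma>) (\<lambda>v. (v, 0)) snd}"

definition cochain_scale ::
    "(complex poly \<Rightarrow> 'v \<Rightarrow> 'v) \<Rightarrow> complex \<Rightarrow> ('r, 'v::zero, 'w) cochain \<Rightarrow> ('r, 'v, 'w) cochain"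
  where "cochain_scale sV c =
    (\<lambda>(f, \<gamma>). (\<lambda>w. cscale sV c (f w), \<lambda>a w. map_poly (cscale sV c) (\<gamma> a w)))"

text \<open>
  The dimension of the complex vector space \<open>Z / B\<close>, as the supremum of the sizes of the finite sets
  that are linearly independent modulo \<open>B\<close>. The value \<open>\<infinity>\<close> is taken for an infinite-dimensional
  quotient, which the library's natural-number valued \<open>dim\<close> would conflate with \<open>0\<close>.
\<close>

definition quotient_dim ::
    "(complex \<Rightarrow> 'x \<Rightarrow> 'x) \<Rightarrow> 'x::comm_monoid_add set \<Rightarrow> 'x set \<Rightarrow> enat"
  where "quotient_dim sc Z B =
    (SUP S\<in>{S. finite S \<and> S \<subseteq> Z \<and> (\<forall>c. (\<Sum>x\<in>S. sc (c x) x) \<in> B \<longrightarrow> (\<forall>x\<in>S. c x = 0))}.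
       enat (card S))"

text \<open>\<open>dim Ext(W, V)\<close>; the module \<open>W\<close> is the quotient and comes first.\<close>

definition dim_Ext ::
    "(complex poly \<Rightarrow> 'r \<Rightarrow> 'r) \<Rightarrow> ('r \<Rightarrow> 'r \<Rightarrow> 'r poly) \<Rightarrow>
     (complex poly \<Rightarrow> 'w::ab_group_add \<Rightarrow> 'w) \<Rightarrow> ('r \<Rightarrow> 'w \<Rightarrow> 'w poly) \<Rightarrow>
     (complex poly \<Rightarrow> 'v::ab_group_add \<Rightarrow> 'v) \<Rightarrow> ('r::ab_group_add \<Rightarrow> 'v \<Rightarrow> 'v poly) \<Rightarrow> enat"
  where "dim_Ext s br sW actW sV actV =
    quotient_dim (cochain_scale sV)
      (cocycles s br sV actV sW actW)
      (trivial_cocycles s br sV actV sW actW)"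


section \<open>Solvable algebras of rank two and their irreducible modules\<close>

text \<open>\<open>q(\<lambda>) x\<close> for a polynomial \<open>q\<close> in \<open>\<lambda>\<close> with constant coefficients.\<close>

definition lam_times ::
    "(complex poly \<Rightarrow> 'x::zero \<Rightarrow> 'x) \<Rightarrow> complex poly \<Rightarrow> 'x \<Rightarrow> 'x poly"
  where "lam_times s q x = map_poly (\<lambda>c. cscale s c x) q"

text \<open>
  A polynomial \<open>Q(\<partial>, \<lambda>)\<close> has type \<^typ>\<open>complex poly poly\<close>, with outer variable \<open>\<lambda>\<close> and inner variable
  \<open>\<partial>\<close>; thus \<open>- \<lambda> - \<partial>\<close> is \<open>[:- [:0, 1:], -1:]\<close>.
\<close>

locale solvable_rank_two = lie_conformal_algebra s br
  for s :: "complex poly \<Rightarrow> 'r::ab_group_add \<Rightarrow> 'r" and br :: "'r \<Rightarrow> 'r \<Rightarrow> 'r poly" +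
  fixes A B :: 'r and p :: "complex poly" and Q :: "complex poly poly"
  assumes solvable: solvable
    and basis_distinct: "A \<noteq> B"
    and basis_independent: "independent {A, B}"
    and basis_span: "span {A, B} = UNIV"
    and br_AA: "br A A = map_poly (\<lambda>q. s q B) Q"
    and br_AB: "br A B = lam_times s p B"
    and br_BB: "br B B = 0"
    and Q_skew: "Q = - pcompose Q [:- [:0, 1:], -1:]"
    and p_Q: "map_poly (\<lambda>c. [:c:]) p * Q = 0"

text \<open>The module \<open>V\<^bsub>\<phi>\<^sub>A,\<phi>\<^sub>B\<^esub>\<close> with its generator \<open>v\<close>.\<close>

locale rank_one_irreducible_module =
  R: solvable_rank_two s br A B p Q + conformal_module s br sV act
  for s :: "complex poly \<Rightarrow> 'r::ab_group_add \<Rightarrow> 'r" and br :: "'r \<Rightarrow> 'r \<Rightarrow> 'r poly"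
    and A B :: 'r and p :: "complex poly" and Q :: "complex poly poly"
    and sV :: "complex poly \<Rightarrow> 'v::ab_group_add \<Rightarrow> 'v" and act :: "'r \<Rightarrow> 'v \<Rightarrow> 'v poly" +
  fixes v :: 'v and \<phi>A \<phi>B :: "complex poly"
  assumes finite_module: finite_module
    and irreducible_module: irreducible_module
    and generator_independent: "M.independent {v}"
    and generator_span: "M.span {v} = UNIV"
    and act_A: "act A v = lam_times sV \<phi>A v"
    and act_B: "act B v = lam_times sV \<phi>B v"
    and nontrivial: "\<not> (\<phi>A = 0 \<and> \<phi>B = 0)"
    and \<phi>B_nonzero: "\<phi>B \<noteq> 0 \<Longrightarrow> p = 0 \<and> Q = 0"

end

theory Submission
  imports Defs
begin

text \<open>
  Lift the generator \<open>c\<^sub>\<eta>\<close> to some \<open>e \<in> E\<close>. Then \<open>(\<partial> - \<eta>) e\<close> lies in \<open>V = \<complex>[\<partial>] v\<close>, say it is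
  \<open>f(\<partial>) v\<close>. Division with remainder by \<open>\<partial> - \<eta>\<close> lets us correct \<open>e\<close> by an element of \<open>V\<close> until
  \<open>(\<partial> - \<eta>) e = k v\<close> with the constant \<open>k = f(\<eta>)\<close>. Applying \<open>a\<^sub>\<lambda>\<close> gives, for every \<open>a \<in> \<R>\<close>,
  \<open>(\<lambda> + \<partial> - \<eta>) (a\<^sub>\<lambda> e) = k (a\<^sub>\<lambda> v)\<close>.

  The left-hand side vanishes under the substitution \<open>\<lambda> = \<eta> - \<partial>\<close>
  (\<open>telescoping_substitution\<close>). For \<open>a = A\<close> and \<open>a = B\<close> the right-hand side becomes
  \<open>k \<phi>\<^sub>A(\<eta> - \<partial>) v\<close> and \<open>k \<phi>\<^sub>B(\<eta> - \<partial>) v\<close>, and as \<open>V\<close> is free on \<open>v\<close> and \<open>\<phi>\<^sub>A\<close>, \<open>\<phi>\<^sub>B\<close> are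
  not both zero, \<open>k = 0\<close> follows (\<open>rank_one_obstruction\<close>). Now \<open>(\<lambda> + \<partial> - \<eta>) (a\<^sub>\<lambda> e) = 0\<close>, and comparing
  the leading coefficients in \<open>\<lambda>\<close> shows \<open>a\<^sub>\<lambda> e = 0\<close>. So \<open>e\<close> spans a copy of \<open>\<complex>c\<^sub>\<eta>\<close> in \<open>E\<close>, which
  splits the extension (\<open>trivial_extension_of_invariant_lift\<close>). As all extensions are trivial, so are
  all cocycles, and the dimension of Ext is zero.
\<close>

section \<open>The operator \<open>\<lambda> + \<partial> - \<eta>\<close>\<close>

text \<open>
  Substituting \<open>\<lambda> = \<eta> - \<partial>\<close> in \<open>(\<lambda> + \<partial> - \<eta>) q\<close> term by term, the contributions of \<open>\<lambda> q\<close> and of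
  \<open>(\<partial> - \<eta>) q\<close> cancel up to a boundary term, which disappears once \<open>N\<close> exceeds the degree of \<open>q\<close>.
\<close>

lemma telescoping_substitution:
  fixes s :: "complex poly \<Rightarrow> 'x::ab_group_add \<Rightarrow> 'x"
  assumes "module s"
  shows "(\<Sum>n\<le>N. s ([:\<eta>, -1:] ^ n) (coeff (pCons 0 q + map_poly (s [:-\<eta>, 1:]) q) n))
    = - s ([:\<eta>, -1:] ^ Suc N) (coeff q N)"
proof -
  interpret module s by fact
  have neg: "[:-\<eta>, 1:] = - [:\<eta>, -1::complex:]" by simp
  have step: "s ([:\<eta>, -1:] ^ n) (s [:-\<eta>, 1:] x) = - s ([:\<eta>, -1:] ^ Suc n) x" for n x
    unfolding neg by (simp only: scale_minus_left scale_scale scale_minus_right power_Suc mult.commute)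
  show ?thesis
  proof (induction N)
    case 0
    show ?case using step[of 0] by (simp add: coeff_map_poly)
  next
    case (Suc N)
    then show ?case
      by (simp add: coeff_map_poly scale_right_distrib step del: power_Suc scale_scale)
  qed
qed

text \<open>If \<open>q\<close> has degree \<open>n\<close> in \<open>\<lambda>\<close>, then its leading coefficient is that of \<open>\<lambda>\<^sup>n\<^sup>+\<^sup>1\<close> in \<open>(\<lambda> + g) q\<close>.\<close>

lemma lambda_plus_operator_injective:
  assumes "pCons 0 q + map_poly g q = 0" and "g 0 = 0"
  shows "q = 0"
proof -
  have "coeff (pCons 0 q + map_poly g q) (Suc (degree q)) = lead_coeff q"
    using assms(2) by (simp add: coeff_map_poly coeff_eq_0)
  then show ?thesis using assms(1) by simp
qed

lemma (in conformal_module) act_der_minus_const: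
  "act a (sV [:-\<eta>, 1:] x) = pCons 0 (act a x) + map_poly (sV [:-\<eta>, 1:]) (act a x)"
proof -
  have split: "sV [:-\<eta>, 1:] y = der sV y + cscale sV (-\<eta>) y" for y
    by (simp flip: M.scale_left_distrib)
  show ?thesis
    by (rule poly_eqI)
      (simp add: split act_add_right act_der_right act_scale_right coeff_map_poly)
qed

lemma (in conformal_module) act_zero_right: "act a 0 = 0"
  using act_add_right[of a 0 0] by simp

lemma (in conformal_module) act_diff_right: "act a (x - y) = act a x - act a y"
  using act_add_right[of a "x - y" y] by simp

lemma scale_eigenvector:
  fixes s :: "complex poly \<Rightarrow> 'x::ab_group_add \<Rightarrow> 'x"
  assumes "module s" and "s [:-\<eta>, 1:] x = 0"
  shows "s q x = s [:poly q \<eta>:] x"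
proof -
  interpret module s by fact
  have "s q x = s (synthetic_div q \<eta> * [:-\<eta>, 1:] + [:poly q \<eta>:]) x"
    using synthetic_div_correct'[of \<eta> q] by (simp only: mult.commute)
  also have "\<dots> = s (synthetic_div q \<eta>) (s [:-\<eta>, 1:] x) + s [:poly q \<eta>:] x"
    by (simp only: scale_left_distrib scale_scale)
  finally show ?thesis using assms(2) by simp
qed

section \<open>Splitting an extension by an invariant lift\<close>

lemma module_sum_scale:
  assumes "module sV" and "module sW"
  shows "module (sum_scale sV sW)"
proof -
  interpret V: module sV by fact
  interpret W: module sW by fact
  show ?thesis
    by unfold_locales
      (auto simp: sum_scale_def V.scale_right_distrib W.scale_right_distrib
        V.scale_left_distrib W.scale_left_distrib)
qed

text \<open>
  The vector \<open>e\<close> spans a submodule which \<open>\<pi>\<close> maps isomorphically onto \<open>\<complex>c\<^sub>\<eta>\<close>, so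
  \<open>x \<mapsto> x - \<pi>(x) e\<close> is a projection of \<open>E\<close> onto \<open>V\<close> which commutes with \<open>\<partial>\<close> and with \<open>\<R>\<close>.
\<close>

lemma trivial_extension_of_invariant_lift:
  assumes ext: "is_extension s br sV act (triv_scale \<eta>) triv_act sE actE \<iota> \<pi>"
    and e_lift: "\<pi> e = 1"
    and e_der: "sE [:-\<eta>, 1:] e = 0"
    and e_act: "\<And>a. actE a e = 0"
  shows "trivial_extension sV act (triv_scale \<eta>) triv_act sE actE \<iota> \<pi>"
proof -
  from ext interpret E: conformal_module s br sE actE
    by (simp add: is_extension_def)
  from ext interpret i: module_hom sV sE \<iota>
    by (simp add: is_extension_def conformal_hom_def)
  from ext interpret p: module_hom sE "triv_scale \<eta>" \<pi>
    by (simp add: is_extension_def conformal_hom_def)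
  from ext have inj: "inj \<iota>" and range: "range \<iota> = {e. \<pi> e = 0}"
    and i_act: "\<And>a u. actE a (\<iota> u) = map_poly \<iota> (act a u)"
    and p_act: "\<And>a x. map_poly \<pi> (actE a x) = 0"
    by (auto simp: is_extension_def conformal_hom_def triv_act_def)
  have p_scale: "\<pi> (sE q x) = poly q \<eta> * \<pi> x" for q x
    by (simp add: p.scale triv_scale_def)
  define \<rho> where "\<rho> = (\<lambda>x. inv \<iota> (x - cscale sE (\<pi> x) e))"
  have i_rho: "\<iota> (\<rho> x) = x - cscale sE (\<pi> x) e" for x
  proof -
    have "x - cscale sE (\<pi> x) e \<in> range \<iota>"
      unfolding range by (simp add: p.diff p_scale e_lift)
    then show ?thesis unfolding \<rho>_def by (rule f_inv_into_f)
  qed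
  have rho_i: "\<rho> (\<iota> u) = u" for u
  proof -
    have "\<pi> (\<iota> u) = 0" using range by auto
    then have "\<iota> (\<rho> (\<iota> u)) = \<iota> u" by (simp add: i_rho)
    then show ?thesis using inj by (simp add: inj_eq)
  qed
  have rho_add: "\<rho> (x + y) = \<rho> x + \<rho> y" for x y
  proof -
    have "cscale sE (\<pi> x + \<pi> y) e = cscale sE (\<pi> x) e + cscale sE (\<pi> y) e"
      by (simp flip: E.M.scale_left_distrib)
    then have "\<iota> (\<rho> (x + y)) = \<iota> (\<rho> x + \<rho> y)"
      by (simp add: i_rho i.add p.add)
    then show ?thesis using inj by (simp add: inj_eq)
  qed
  have rho_scale: "\<rho> (sE q x) = sV q (\<rho> x)" for q x
  proof -
    have "sE q (cscale sE (\<pi> x) e) = cscale sE (\<pi> (sE q x)) e"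
      using scale_eigenvector[OF E.M.module_axioms e_der, of "q * [:\<pi> x:]"]
      by (simp add: p_scale mult.commute)
    then have "\<iota> (\<rho> (sE q x)) = \<iota> (sV q (\<rho> x))"
      by (simp add: i_rho i.scale E.M.scale_right_diff_distrib)
    then show ?thesis using inj by (simp add: inj_eq)
  qed
  define h where "h = (\<lambda>x. (\<rho> x, \<pi> x))"
  have h_0: "h 0 = 0"
    using rho_i[of 0] by (simp add: h_def zero_prod_def)
  have h_act: "sum_act act triv_act a (h x) = map_poly h (actE a x)" for a x
  proof (rule poly_eqI)
    fix n
    have "coeff (map_poly \<pi> (actE a x)) n = 0" by (simp add: p_act)
    then have p_coeff: "\<pi> (coeff (actE a x) n) = 0" by (simp add: coeff_map_poly)
    have "\<iota> (coeff (act a (\<rho> x)) n) = coeff (actE a (\<iota> (\<rho> x))) n"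
      by (simp add: i_act coeff_map_poly)
    also have "\<dots> = \<iota> (\<rho> (coeff (actE a x) n))"
      by (simp add: i_rho E.act_diff_right E.act_scale_right e_act p_coeff)
    finally have "coeff (act a (\<rho> x)) n = \<rho> (coeff (actE a x) n)"
      using inj by (simp add: inj_eq)
    then have "coeff (sum_act act triv_act a (h x)) n = (\<rho> (coeff (actE a x) n), 0)"
      by (simp add: coeff_map_poly h_def sum_act_def triv_act_def zero_prod_def)
    also have "\<dots> = coeff (map_poly h (actE a x)) n"
      unfolding coeff_map_poly[of h, OF h_0] by (simp add: h_def p_coeff)
    finally show "coeff (sum_act act triv_act a (h x)) n = coeff (map_poly h (actE a x)) n" .
  qed
  interpret S: module "sum_scale sV (triv_scale \<eta>)"
    by (rule module_sum_scale) unfold_locales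
  have "module_hom sE (sum_scale sV (triv_scale \<eta>)) h"
    by unfold_locales (simp_all add: h_def rho_add rho_scale p.add p.scale sum_scale_def)
  then have "conformal_hom sE actE (sum_scale sV (triv_scale \<eta>)) (sum_act act triv_act) h"
    by (simp add: conformal_hom_def h_act)
  moreover have "h \<circ> \<iota> = (\<lambda>u. (u, 0))"
    using range by (auto simp: h_def rho_i fun_eq_iff)
  moreover have "snd \<circ> h = \<pi>"
    by (auto simp: h_def)
  ultimately show ?thesis
    unfolding trivial_extension_def equivalent_extensions_def by blast
qed

section \<open>Extensions of the one-dimensional module by a rank one module\<close>

text \<open>
  The vector \<open>\<kappa> v\<close> is the failure of \<open>e\<close> to be an eigenvector of \<open>\<partial>\<close> for \<open>\<eta>\<close>. Substituting
  \<open>\<lambda> = \<eta> - \<partial>\<close> in \<open>(\<lambda> + \<partial> - \<eta>) (a\<^sub>\<lambda> e) = \<kappa> \<phi>(\<lambda>) v\<close> leaves \<open>\<kappa> \<phi>(\<eta> - \<partial>) v = 0\<close>, where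
  freeness lets us cancel \<open>v\<close>, and \<open>\<partial> \<mapsto> \<eta> - \<partial>\<close> is an automorphism of \<open>\<complex>[\<partial>]\<close>.
\<close>

lemma rank_one_obstruction:
  assumes E: "conformal_module s br sE actE"
    and hom: "module_hom sV sE \<iota>" and inj: "inj \<iota>"
    and i_act: "\<And>u. actE a (\<iota> u) = map_poly \<iota> (act a u)"
    and free: "\<And>q. sV q v = 0 \<Longrightarrow> q = 0"
    and act: "act a v = lam_times sV \<phi> v"
    and e: "sE [:-\<eta>, 1:] e = \<iota> (cscale sV \<kappa> v)"
  shows "\<kappa> = 0 \<or> \<phi> = 0"
proof -
  interpret E: conformal_module s br sE actE by fact
  interpret i: module_hom sV sE \<iota> by fact
  define r where "r = actE a (sE [:-\<eta>, 1:] e)"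
  have coeff_r: "coeff r n = \<iota> (sV [:\<kappa> * coeff \<phi> n:] v)" for n
    unfolding r_def e
    by (simp add: E.act_scale_right i_act act lam_times_def coeff_map_poly i.scale mult.commute)
  \<comment> \<open>Beyond both degrees the boundary term vanishes and the sum runs over all of \<open>\<phi>\<close>.\<close>
  define N where "N = max (degree \<phi>) (Suc (degree (actE a e)))"
  have "degree \<phi> \<le> N" and "degree (actE a e) < N" by (auto simp: N_def)
  have "pcompose \<phi> [:\<eta>, -1:] = (\<Sum>n\<le>degree \<phi>. [:coeff \<phi> n:] * [:\<eta>, -1:] ^ n)"
    by (simp add: pcompose_altdef poly_altdef coeff_map_poly degree_map_poly)
  also have "\<dots> = (\<Sum>n\<le>N. [:coeff \<phi> n:] * [:\<eta>, -1:] ^ n)"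
    using \<open>degree \<phi> \<le> N\<close> by (intro sum.mono_neutral_left) (auto simp: coeff_eq_0)
  finally have comp: "[:\<kappa>:] * pcompose \<phi> [:\<eta>, -1:]
      = (\<Sum>n\<le>N. [:\<eta>, -1:] ^ n * [:\<kappa> * coeff \<phi> n:])"
    by (simp only: sum_distrib_left) (rule sum.cong, simp_all add: mult.commute)
  have "\<iota> (sV ([:\<kappa>:] * pcompose \<phi> [:\<eta>, -1:]) v)
      = (\<Sum>n\<le>N. sE ([:\<eta>, -1:] ^ n) (coeff r n))"
    unfolding comp coeff_r by (simp only: i.m1.scale_sum_left i.sum i.m1.scale_scale flip: i.scale)
  also have "\<dots> = 0"
    unfolding r_def E.act_der_minus_const telescoping_substitution[OF E.M.module_axioms]
    using \<open>degree (actE a e) < N\<close> by (simp add: coeff_eq_0)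
  finally have "sV ([:\<kappa>:] * pcompose \<phi> [:\<eta>, -1:]) v = 0"
    using inj i.zero by (metis injD)
  then have "[:\<kappa>:] * pcompose \<phi> [:\<eta>, -1:] = 0" by (rule free)
  then show ?thesis by (auto simp: pcompose_eq_0_iff)
qed

text \<open>
  Since one of \<open>\<phi>\<^sub>A\<close>, \<open>\<phi>\<^sub>B\<close> is nonzero, the obstruction forces the remainder \<open>f(\<eta>)\<close> to vanish for
  the lift corrected by the quotient of \<open>f\<close> by \<open>\<partial> - \<eta>\<close>, and this lift is then invariant.
\<close>

theorem trivial_extension_of_rank_one:
  assumes V: "rank_one_irreducible_module s br A B p Q sV act v \<phi>A \<phi>B"
    and ext: "is_extension s br sV act (triv_scale \<eta>) triv_act sE actE \<iota> \<pi>"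
  shows "trivial_extension sV act (triv_scale \<eta>) triv_act sE actE \<iota> \<pi>"
proof -
  interpret V: rank_one_irreducible_module s br A B p Q sV act v \<phi>A \<phi>B by fact
  from ext interpret E: conformal_module s br sE actE
    by (simp add: is_extension_def)
  from ext interpret i: module_hom sV sE \<iota>
    by (simp add: is_extension_def conformal_hom_def)
  from ext interpret p: module_hom sE "triv_scale \<eta>" \<pi>
    by (simp add: is_extension_def conformal_hom_def)
  from ext have inj: "inj \<iota>" and range: "range \<iota> = {e. \<pi> e = 0}" and "surj \<pi>"
    and i_act: "\<And>a u. actE a (\<iota> u) = map_poly \<iota> (act a u)"
    by (auto simp: is_extension_def conformal_hom_def)
  have p_i: "\<pi> (\<iota> u) = 0" for u using range by auto
  have free: "q = 0" if "sV q v = 0" for q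
    using V.generator_independent that
    by (auto simp: V.M.dependent_explicit dest!: spec[where x = "{v}"] spec[where x = "\<lambda>_. q"])
  obtain e\<^sub>0 where e\<^sub>0: "\<pi> e\<^sub>0 = 1"
    using \<open>surj \<pi>\<close> by (metis surjD)
  have "\<pi> (sE [:-\<eta>, 1:] e\<^sub>0) = 0"
    by (simp add: p.scale triv_scale_def)
  then obtain u where u: "sE [:-\<eta>, 1:] e\<^sub>0 = \<iota> u"
    using range by blast
  obtain f where f: "u = sV f v"
    using V.generator_span V.M.span_singleton[of v] by auto
  define g where "g = synthetic_div f \<eta>"
  define e where "e = e\<^sub>0 - \<iota> (sV g v)"
  have "\<pi> e = 1" by (simp add: e_def p.diff p_i e\<^sub>0)
  have e_der: "sE [:-\<eta>, 1:] e = \<iota> (cscale sV (poly f \<eta>) v)"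
  proof -
    have "f - [:-\<eta>, 1:] * g = [:poly f \<eta>:]"
      using synthetic_div_correct'[of \<eta> f] unfolding g_def by (metis add_diff_cancel_left')
    then have "sV f v - sV [:-\<eta>, 1:] (sV g v) = cscale sV (poly f \<eta>) v"
      by (metis V.M.scale_scale V.M.scale_left_diff_distrib)
    then show ?thesis
      by (simp only: e_def E.M.scale_right_diff_distrib u f flip: i.scale i.diff)
  qed
  have "poly f \<eta> = 0 \<or> \<phi> = 0" if "act a v = lam_times sV \<phi> v" for a \<phi>
    using E.conformal_module_axioms i.module_hom_axioms inj i_act free that e_der
    by (rule rank_one_obstruction)
  then have "poly f \<eta> = 0"
    using V.act_A V.act_B V.nontrivial by blast
  then have e_inv: "sE [:-\<eta>, 1:] e = 0"
    using e_der i.zero by simp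
  have "actE a e = 0" for a
  proof (rule lambda_plus_operator_injective)
    show "pCons 0 (actE a e) + map_poly (sE [:-\<eta>, 1:]) (actE a e) = 0"
      using E.act_der_minus_const[of a \<eta> e] by (simp add: e_inv E.act_zero_right)
  qed simp
  with ext \<open>\<pi> e = 1\<close> e_inv show ?thesis
    by (rule trivial_extension_of_invariant_lift)
qed

section \<open>Vanishing of Ext\<close>

text \<open>
  The scaling laws at \<open>0\<close> and \<open>1\<close> are what it takes to write one element of \<open>Z\<close> as a linear
  combination over a finite set containing it.
\<close>

lemma quotient_dim_eq_0:
  assumes "Z \<subseteq> B" and one: "\<And>x. x \<in> Z \<Longrightarrow> sc 1 x = x" and zero: "\<And>x. x \<in> Z \<Longrightarrow> sc 0 x = 0"
  shows "quotient_dim sc Z B = 0"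
proof -
  have "S = {}" if "finite S" "S \<subseteq> Z"
    and indep: "\<And>c. (\<Sum>x\<in>S. sc (c x) x) \<in> B \<Longrightarrow> \<forall>x\<in>S. c x = 0" for S
  proof (rule ccontr)
    assume "S \<noteq> {}"
    then obtain y where y: "y \<in> S" by blast
    \<comment> \<open>A single element of \<open>S\<close> already is a vanishing combination modulo \<open>B\<close>.\<close>
    define c :: "_ \<Rightarrow> complex" where "c = (\<lambda>x. if x = y then 1 else 0)"
    have "(\<Sum>x\<in>S. sc (c x) x) = (\<Sum>x\<in>S. if x = y then x else 0)"
      using \<open>S \<subseteq> Z\<close> by (intro sum.cong) (auto simp: c_def one zero)
    also have "\<dots> = y"
      using y \<open>finite S\<close> by simp
    finally have "(\<Sum>x\<in>S. sc (c x) x) \<in> B"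
      using y \<open>S \<subseteq> Z\<close> \<open>Z \<subseteq> B\<close> by auto
    then have "c y = 0" using indep y by blast
    then show False by (simp add: c_def)
  qed
  then have "quotient_dim sc Z B \<le> 0"
    unfolding quotient_dim_def by (intro SUP_least) (auto simp: zero_enat_def)
  then show ?thesis by simp
qed

lemma cochain_scale_one:
  assumes "module sV"
  shows "cochain_scale sV 1 x = x"
proof -
  interpret module sV by fact
  have "cscale sV 1 = (\<lambda>y. y)" by (auto simp flip: one_pCons)
  then show ?thesis by (simp add: cochain_scale_def split: prod.split)
qed

lemma cochain_scale_zero:
  assumes "module sV"
  shows "cochain_scale sV 0 x = 0"
proof -
  interpret module sV by fact
  have "map_poly (cscale sV 0) q = 0" for q
    by (rule poly_eqI) (simp add: coeff_map_poly)
  then show ?thesis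
    by (simp add: cochain_scale_def zero_prod_def zero_fun_def split: prod.split)
qed

theorem theorem4p5:
  fixes s :: "complex poly \<Rightarrow> 'r::ab_group_add \<Rightarrow> 'r"
    and br :: "'r \<Rightarrow> 'r \<Rightarrow> 'r poly"
    and A B :: 'r
    and p :: "complex poly"
    and Q :: "complex poly poly"
    and sV :: "complex poly \<Rightarrow> 'v::ab_group_add \<Rightarrow> 'v"
    and act :: "'r \<Rightarrow> 'v \<Rightarrow> 'v poly"
    and v :: 'v
    and \<phi>A \<phi>B :: "complex poly"
    and \<eta> :: complex
  assumes "solvable_rank_two s br A B p Q"
    and "rank_one_irreducible_module s br A B p Q sV act v \<phi>A \<phi>B"
  shows "\<not> (\<exists>(sE :: complex poly \<Rightarrow> 'e::ab_group_add \<Rightarrow> 'e) actE \<iota> \<pi>.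
              is_extension s br sV act (triv_scale \<eta>) triv_act sE actE \<iota> \<pi> \<and>
              \<not> trivial_extension sV act (triv_scale \<eta>) triv_act sE actE \<iota> \<pi>) \<and>
         dim_Ext s br (triv_scale \<eta>) triv_act sV act = 0"
proof
  show "\<not> (\<exists>(sE :: complex poly \<Rightarrow> 'e::ab_group_add \<Rightarrow> 'e) actE \<iota> \<pi>.
              is_extension s br sV act (triv_scale \<eta>) triv_act sE actE \<iota> \<pi> \<and>
              \<not> trivial_extension sV act (triv_scale \<eta>) triv_act sE actE \<iota> \<pi>)"
    using trivial_extension_of_rank_one[OF assms(2)] by blast
next
  interpret V: rank_one_irreducible_module s br A B p Q sV act v \<phi>A \<phi>B by fact
  have "cocycles s br sV act (triv_scale \<eta>) triv_act
      \<subseteq> trivial_cocycles s br sV act (triv_scale \<eta>) triv_act"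
    using trivial_extension_of_rank_one[OF assms(2)]
    by (auto simp: cocycles_def trivial_cocycles_def)
  then show "dim_Ext s br (triv_scale \<eta>) triv_act sV act = 0"
    unfolding dim_Ext_def
    by (rule quotient_dim_eq_0)
      (simp_all add: cochain_scale_one cochain_scale_zero V.M.module_axioms)
qed

end
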